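(* Let $(\mathbb{S},\oplus,\otimes,0_{\mathbb{S}},1_{\mathbb{S}},\succeq,d)$ be a metric partially ordered pseudo-semiring and let $(\Omega,\mathcal{F},\perp,\parallel,\mathbb{P})$ be a probability space whose abstract probability measure $\mathbb{P}$ takes values in $\mathbb{S}$. Then for all $A,B\in\mathcal{F}$ the following hold: (1) if $A\subseteq B$, then $\mathbb{P}(B\setminus A)\oplus\mathbb{P}(A)=\mathbb{P}(B)$; (2) $\mathbb{P}(A)\oplus\mathbb{P}(A^{\mathrm{C}})=1_{\mathbb{S}}$, where $A^{\mathrm{C}}=\Omega\setminus A$; (3) $1_{\mathbb{S}}\succeq\mathbb{P}(A)\succeq 0_{\mathbb{S}}$; (4) $\mathbb{P}(A\cup B)\oplus\mathbb{P}(A\cap B)=\mathbb{P}(A)\oplus\mathbb{P}(B)$.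
   Context: Metric partially ordered pseudo-semiring: a tuple $(\mathbb{S},\oplus,\otimes,0_{\mathbb{S}},1_{\mathbb{S}},\succeq,d)$ such that (i) $(\mathbb{S},\succeq)$ is a (non-strict) partially ordered set ($a\preceq b$ means $b\succeq a$); (ii) $\oplus,\otimes:\mathbb{S}\times\mathbb{S}\to\mathbb{S}$ are commutative and associative, $0_{\mathbb{S}}$ is an identity for $\oplus$, $1_{\mathbb{S}}$ is an identity for $\otimes$, addition is monotone ($b\succeq c\Rightarrow a\oplus b\succeq a\oplus c$ for all $a$), multiplication by non-negative elements is monotone ($b\succeq c\Rightarrow a\otimes b\succeq a\otimes c$ for all $a\succeq 0_{\mathbb{S}}$), and $a\otimes(b\oplus c)=(a\otimes b)\oplus(a\otimes c)$ for all $a,b,c$; (iii) $(\mathbb{S},d)$ is a metric space such that whenever $a_n\to a$ and $b_n\to b$ in $d$: if $a_n\preceq b_n$ for all $n$ then $a\preceq b$; $a_n\oplus b_n\to a\oplus b$; and $a_n\otimes b_n\to a\otimes b$. Limits in $\mathbb{S}$ are with respect to $d$, and $[0_{\mathbb{S}},1_{\mathbb{S}}]=\{s\in\mathbb{S}:0_{\mathbb{S}}\preceq s\preceq 1_{\mathbb{S}}\}$. Let $(\Omega,\mathcal{F})$ be a measurable space ($\mathcal{F}$ a $\sigma$-algebra on $\Omega$); elements of $\mathcal{F}$ are called events. Exclusivity relation: $A\parallel B$ iff $A\cap B=\emptyset$; then $A,B$ are called mutually exclusive. A countable collection is mutually exclusive iff every event is mutually exclusive with every intersection of the other events; the paper treats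 this as equivalent to the events being pairwise disjoint. Independence relation: a relation $\perp$ on $\mathcal{F}$ such that for all $A,B,C\in\mathcal{F}$: $\neg(A\perp A)$; $A\perp B\Leftrightarrow B\perp A$; $A\perp\Omega$; $(A\perp C)\wedge(B\perp C)\Rightarrow(A\cup B)\perp C$; $(A\perp C)\wedge(B\perp C)\Rightarrow(A\cap B)\perp C$; $A\perp B\Rightarrow A^{\mathrm{C}}\perp B$. Two events $A,B$ with $A\cap B\neq\emptyset$ are mutually independent iff $A\perp B$; a collection of events is mutually independent iff every event is independent of every intersection of the other events. The pair $(\parallel,\perp)$ is called a complex of conditions. Abstract probability measure: a function $\mathbb{P}:\mathcal{F}\to[0_{\mathbb{S}},1_{\mathbb{S}}]$ such that: $\mathbb{P}(A)\in\mathbb{S}$ and $\mathbb{P}(A)\succeq 0_{\mathbb{S}}$ for all $A\in\mathcal{F}$; $\mathbb{P}(\emptyset)=0_{\mathbb{S}}$; $A\subset B\Rightarrow\mathbb{P}(A)\preceq\mathbb{P}(B)$; for every countable sequence $\{A_i\}\subset\mathcal{F}$ of mutually exclusive events, $\mathbb{P}(\bigcup_{i=1}^{\infty}A_i)=\bigoplus_{i=1}^{\infty}\mathbb{P}(A_i)=\lim_{n\to\infty}\bigoplus_{i=1}^{n}\mathbb{P}(A_i)$; $\mathbb{P}(\Omega)=1_{\mathbb{S}}$; for every countable sequence $\{A_i\}\subset\mathcal{F}$ of mutually independent events, $\mathbb{P}(\bigcap_{i=1}^{\infty}A_i)=\bigotimes_{i=1}^{\infty}\mathbb{P}(A_i)=\lim_{n\to\infty}\bigotimes_{i=1}^{n}\mathbb{P}(A_i)$.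 Probability space: a tuple $(\Omega,\mathcal{F},\perp,\parallel,\mathbb{P})$ consisting of a measurable space with a complex of conditions and an abstract probability measure on it.
   Formalization: The independence axioms as printed are inconsistent (A ⊥ Ω for all A gives Ω ⊥ Ω, against ¬(A ⊥ A)); here ¬(A ⊥ A) is required only for events A other than ∅ and Ω. *)

theory Defs
  imports "HOL-Analysis.Sigma_Algebra" "HOL-Library.Indicator_Function"
begin

text \<open>
  The carrier is the whole type. Only the algebraic laws below are required; in particular,
  \<open>0 * a = 0\<close> and \<open>0 \<noteq> 1\<close> are not assumed, so \<open>comm_semiring_0\<close> and \<open>comm_semiring_1\<close> are too
  strong. Monotonicity of addition is \<open>add_left_mono\<close> of \<open>ordered_ab_semigroup_add\<close>, and the metric
  is \<open>dist\<close>, which induces the topology of all limits.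
\<close>

class metric_po_pseudo_semiring =
  comm_semiring + comm_monoid_add + comm_monoid_mult + ordered_ab_semigroup_add + metric_space +
  assumes mult_left_mono_nonneg: "b \<le> c \<Longrightarrow> 0 \<le> a \<Longrightarrow> a * b \<le> a * c"
    and LIMSEQ_mono: "X \<longlonglongrightarrow> a \<Longrightarrow> Y \<longlonglongrightarrow> b \<Longrightarrow> (\<forall>n. X n \<le> Y n) \<Longrightarrow> a \<le> b"
    and LIMSEQ_add: "X \<longlonglongrightarrow> a \<Longrightarrow> Y \<longlonglongrightarrow> b \<Longrightarrow> (\<lambda>n. X n + Y n) \<longlonglongrightarrow> a + b"
    and LIMSEQ_mult: "X \<longlonglongrightarrow> a \<Longrightarrow> Y \<longlonglongrightarrow> b \<Longrightarrow> (\<lambda>n. X n * Y n) \<longlonglongrightarrow> a * b"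

definition exclusive :: "'o set \<Rightarrow> 'o set \<Rightarrow> bool" where
  "exclusive A B \<longleftrightarrow> A \<inter> B = {}"

text \<open>
  A sequence is treated as an indexed family, so an event that occurs at two indices counts as
  one of the ``other'' events; intersections range over nonempty index sets.
\<close>

definition mutually_exclusive :: "(nat \<Rightarrow> 'o set) \<Rightarrow> bool" where
  "mutually_exclusive A \<longleftrightarrow>
     (\<forall>i J. J \<noteq> {} \<longrightarrow> i \<notin> J \<longrightarrow> exclusive (A i) (\<Inter>j\<in>J. A j))"

lemma mutually_exclusive_iff_disjoint_family:
  "mutually_exclusive A \<longleftrightarrow> disjoint_family A"
proof
  assume A: "mutually_exclusive A"
  have "A i \<inter> A j = {}" if "i \<noteq> j" for i j
    using A[unfolded mutually_exclusive_def exclusive_def, rule_format, of "{j}" i] that by simp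
  then show "disjoint_family A" by (simp add: disjoint_family_on_def)
next
  assume A: "disjoint_family A"
  show "mutually_exclusive A"
    unfolding mutually_exclusive_def exclusive_def
  proof (intro allI impI)
    fix i and J :: "nat set"
    assume "J \<noteq> {}" and "i \<notin> J"
    then obtain j where "j \<in> J" and "i \<noteq> j" by auto
    then have "A i \<inter> A j = {}" using A by (simp add: disjoint_family_on_def)
    with \<open>j \<in> J\<close> show "A i \<inter> (\<Inter>j\<in>J. A j) = {}" by blast
  qed
qed

text \<open>
  Irreflexivity is demanded only of events other than \<open>{}\<close> and \<open>\<Omega>\<close>. Demanded of all events it would
  contradict \<open>indep_space\<close>, which gives \<open>indep \<Omega> \<Omega>\<close>; \<open>indep {} {}\<close> is forced as well
  (see \<open>indep_trivial\<close> below).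
\<close>

locale independence_relation = sigma_algebra \<Omega> \<F>
  for \<Omega> :: "'o set" and \<F> :: "'o set set" +
  fixes indep :: "'o set \<Rightarrow> 'o set \<Rightarrow> bool"
  assumes indep_irrefl: "A \<in> \<F> \<Longrightarrow> A \<noteq> {} \<Longrightarrow> A \<noteq> \<Omega> \<Longrightarrow> \<not> indep A A"
    and indep_sym: "A \<in> \<F> \<Longrightarrow> B \<in> \<F> \<Longrightarrow> indep A B \<longleftrightarrow> indep B A"
    and indep_space: "A \<in> \<F> \<Longrightarrow> indep A \<Omega>"
    and indep_Un: "A \<in> \<F> \<Longrightarrow> B \<in> \<F> \<Longrightarrow> C \<in> \<F> \<Longrightarrow> indep A C \<Longrightarrow> indep B C \<Longrightarrow> indep (A \<union> B) C"
    and indep_Int: "A \<in> \<F> \<Longrightarrow> B \<in> \<F> \<Longrightarrow> C \<in> \<F> \<Longrightarrow> indep A C \<Longrightarrow> indep B C \<Longrightarrow> indep (A \<inter> B) C"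
    and indep_compl: "A \<in> \<F> \<Longrightarrow> B \<in> \<F> \<Longrightarrow> indep A B \<Longrightarrow> indep (\<Omega> - A) B"
begin

lemma indep_trivial: "indep \<Omega> \<Omega>" "indep {} {}"
proof -
  show *: "indep \<Omega> \<Omega>" by (simp add: indep_space)
  have "indep {} \<Omega>" by (simp add: indep_space)
  then have "indep \<Omega> {}" using indep_sym by blast
  from indep_compl[OF _ _ this] show "indep {} {}" by simp
qed

text \<open>
  For two events the notion is reserved to those that meet; the same proviso is applied when an
  event is compared with an intersection of other members of a sequence.
\<close>

definition independent_pair :: "'o set \<Rightarrow> 'o set \<Rightarrow> bool" where
  "independent_pair A B \<longleftrightarrow> A \<inter> B \<noteq> {} \<and> indep A B"

definition mutually_independent :: "(nat \<Rightarrow> 'o set) \<Rightarrow> bool" where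
  "mutually_independent A \<longleftrightarrow>
     (\<forall>i J. J \<noteq> {} \<longrightarrow> i \<notin> J \<longrightarrow> independent_pair (A i) (\<Inter>j\<in>J. A j))"

end

locale abstract_probability_space = independence_relation \<Omega> \<F> indep
  for \<Omega> :: "'o set" and \<F> :: "'o set set" and indep :: "'o set \<Rightarrow> 'o set \<Rightarrow> bool" +
  fixes P :: "'o set \<Rightarrow> 's::metric_po_pseudo_semiring"
  assumes P_range: "P \<in> \<F> \<rightarrow> {0..1}"
    and P_nonneg: "A \<in> \<F> \<Longrightarrow> 0 \<le> P A"
    and P_empty: "P {} = 0"
    and P_mono: "A \<in> \<F> \<Longrightarrow> B \<in> \<F> \<Longrightarrow> A \<subseteq> B \<Longrightarrow> P A \<le> P B"
    and P_UN: "range E \<subseteq> \<F> \<Longrightarrow> mutually_exclusive E \<Longrightarrow>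
      (\<lambda>n. \<Sum>i<n. P (E i)) \<longlonglongrightarrow> P (\<Union>i. E i)"
    and P_space: "P \<Omega> = 1"
    and P_INT: "range E \<subseteq> \<F> \<Longrightarrow> mutually_independent E \<Longrightarrow>
      (\<lambda>n. \<Prod>i<n. P (E i)) \<longlonglongrightarrow> P (\<Inter>i. E i)"

end

theory Submission
  imports Defs "HOL-Analysis.Measure_Space"
begin

text \<open>Everything rests on finite additivity (\<open>P_Un_disjoint\<close>), which is countable
  additivity applied to two disjoint events padded with empty sets. The identities then come from
  cutting events into disjoint pieces: \<open>B\<close> into \<open>B - A\<close> and
  \<open>A\<close> when A \<subseteq> B, and \<open>A \<union> B\<close> into \<open>A\<close> and
  \<open>B - A\<close>. Only sums of pieces are compared, never differences, since elements of the
  value structure need not have negatives.\<close>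

context abstract_probability_space
begin

lemma P_Un_disjoint:
  assumes "A \<in> \<F>" and "B \<in> \<F>" and "A \<inter> B = {}"
  shows "P (A \<union> B) = P A + P B"
proof -
  \<comment> \<open>\<open>binaryset A B\<close> is the sequence A, B, {}, {}, ...; the repeated {}
    is harmless, being disjoint from itself.\<close>
  have "mutually_exclusive (binaryset A B)"
    unfolding mutually_exclusive_iff_disjoint_family
    using assms(3) by (auto simp: disjoint_family_on_def binaryset_def)
  moreover have "range (binaryset A B) \<subseteq> \<F>"
    using assms by (simp add: range_binaryset_eq)
  ultimately have "(\<lambda>n. \<Sum>i<n. P (binaryset A B i)) \<longlonglongrightarrow> P (A \<union> B)"
    using P_UN[of "binaryset A B"] by (simp add: UN_binaryset_eq)
  \<comment> \<open>As \<open>P {} = 0\<close>, the partial sums are constant from n = 2 on.\<close>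
  moreover have "(\<lambda>n. \<Sum>i<n. P (binaryset A B i)) \<longlonglongrightarrow> P A + P B"
    by (rule LIMSEQ_binaryset) (rule P_empty)
  ultimately show ?thesis
    by (rule LIMSEQ_unique)
qed

lemma P_Diff_add:
  assumes "A \<in> \<F>" and "B \<in> \<F>" and "A \<subseteq> B"
  shows "P (B - A) + P A = P B"
  using P_Un_disjoint[of "B - A" A] assms by (simp add: Diff Un_absorb2 Int_commute)

lemma P_Un_Int:
  assumes "A \<in> \<F>" and "B \<in> \<F>"
  shows "P (A \<union> B) + P (A \<inter> B) = P A + P B"
proof -
  have "P (A \<union> B) = P A + P (B - A)"
    using P_Un_disjoint[of A "B - A"] assms by (simp add: Diff)
  moreover have "P B = P (B - A) + P (A \<inter> B)"
    using P_Diff_add[of "A \<inter> B" B] assms by (simp add: Int Diff_Int)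
  ultimately show ?thesis
    by (simp add: add.assoc)
qed

end

theorem theorem2p1:
  fixes \<Omega> :: "'o set" and \<F> :: "'o set set"
    and indep :: "'o set \<Rightarrow> 'o set \<Rightarrow> bool"
    and P :: "'o set \<Rightarrow> 's::metric_po_pseudo_semiring"
    and A B :: "'o set"
  assumes "abstract_probability_space \<Omega> \<F> indep P"
    and "A \<in> \<F>" and "B \<in> \<F>"
  shows "(A \<subseteq> B \<longrightarrow> P (B - A) + P A = P B)
    \<and> P A + P (\<Omega> - A) = 1
    \<and> (P A \<le> 1 \<and> 0 \<le> P A)
    \<and> P (A \<union> B) + P (A \<inter> B) = P A + P B"
proof -
  interpret abstract_probability_space \<Omega> \<F> indep P
    by fact
  \<comment> \<open>The difference rule for A \<subseteq> \<Omega>, with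
    \<open>P \<Omega> = 1\<close>.\<close>
  have "P A + P (\<Omega> - A) = 1"
    using P_Diff_add[OF \<open>A \<in> \<F>\<close> top sets_into_space[OF \<open>A \<in> \<F>\<close>]]
    by (simp add: P_space add.commute)
  moreover have "P A \<le> 1" and "0 \<le> P A"
    using P_range \<open>A \<in> \<F>\<close> by auto
  ultimately show ?thesis
    using P_Diff_add P_Un_Int assms(2,3) by blast
qed

end
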